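(* Let $d,\nu,t,m_1,\dots,m_d$ be positive integers with $d\ge 2$, $m_1\ge m_2\ge\cdots\ge m_d\ge t$ and $2\nu\ge 2m_1+m_2+1$. Suppose $\mathcal F_i\subseteq\mathcal P_{m_i}$ ($i=1,\dots,d$) satisfy $\dim(F_1\cap\cdots\cap F_d)\ge t$ for all choices $F_i\in\mathcal F_i$, and that $\prod_{i=1}^d|\mathcal F_i|$ is maximum among all such $d$-tuples of families. Then there exists $T\in\mathcal P_t$ such that $\mathcal F_i=\{F\in\mathcal P_{m_i}: T\subseteq F\}$ for every $i\in\{1,\dots,d\}$.
   Context: Let $q$ be a prime power, $\nu\ge 1$ an integer, and $f$ a non-degenerate alternating bilinear form on $V=\mathbb F_q^{2\nu}$. A subspace $W\le V$ is totally isotropic if $f(x,y)=0$ for all $x,y\in W$ (maximal totally isotropic subspaces have dimension $\nu$). For $0\le m\le \nu$, $\mathcal P_m$ denotes the set of all $m$-dimensional totally isotropic subspaces of $V$. *)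

theory Defs
  imports "HOL-Analysis.Analysis"
begin

text \<open>Symplectic space: V = F_q^{2 nu} modelled as 'a ^ 'n with CARD('n) = 2 nu,
  'a a finite field (its order is automatically a prime power).\<close>

definition bilinear_form :: "('a::field ^ 'n \<Rightarrow> 'a ^ 'n \<Rightarrow> 'a) \<Rightarrow> bool" where
  "bilinear_form f \<longleftrightarrow>
     (\<forall>x y z. f (x + y) z = f x z + f y z) \<and>
     (\<forall>x y z. f x (y + z) = f x y + f x z) \<and>
     (\<forall>c x y. f (c *s x) y = c * f x y) \<and>
     (\<forall>c x y. f x (c *s y) = c * f x y)"

definition alternating_form :: "('a::field ^ 'n \<Rightarrow> 'a ^ 'n \<Rightarrow> 'a) \<Rightarrow> bool" where
  "alternating_form f \<longleftrightarrow> (\<forall>x. f x x = 0)"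

definition nondegenerate_form :: "('a::field ^ 'n \<Rightarrow> 'a ^ 'n \<Rightarrow> 'a) \<Rightarrow> bool" where
  "nondegenerate_form f \<longleftrightarrow> (\<forall>x. (\<forall>y. f x y = 0) \<longrightarrow> x = 0)"

definition totally_isotropic ::
  "('a::field ^ 'n \<Rightarrow> 'a ^ 'n \<Rightarrow> 'a) \<Rightarrow> ('a ^ 'n) set \<Rightarrow> bool" where
  "totally_isotropic f W \<longleftrightarrow> vec.subspace W \<and> (\<forall>x\<in>W. \<forall>y\<in>W. f x y = 0)"

definition TI_subspaces ::
  "('a::field ^ 'n \<Rightarrow> 'a ^ 'n \<Rightarrow> 'a) \<Rightarrow> nat \<Rightarrow> ('a ^ 'n) set set" where
  "TI_subspaces f m = {W. totally_isotropic f W \<and> vec.dim W = m}"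

definition t_intersecting_tuple ::
  "('a::field ^ 'n \<Rightarrow> 'a ^ 'n \<Rightarrow> 'a) \<Rightarrow> nat \<Rightarrow> (nat \<Rightarrow> nat) \<Rightarrow> nat
     \<Rightarrow> (nat \<Rightarrow> ('a ^ 'n) set set) \<Rightarrow> bool" where
  "t_intersecting_tuple f d m t \<F> \<longleftrightarrow>
     (\<forall>i\<in>{1..d}. \<F> i \<subseteq> TI_subspaces f (m i)) \<and>
     (\<forall>G. (\<forall>i\<in>{1..d}. G i \<in> \<F> i) \<longrightarrow> t \<le> vec.dim (\<Inter>i\<in>{1..d}. G i))"

end

theory Submission imports Defs begin

text \<open>
  For two families \<open>A \<subseteq> P\<^sub>a\<close> and \<open>B \<subseteq> P\<^sub>b\<close> let \<open>s\<close> and \<open>r\<close> be the least dimensions of subspaces meeting every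
  member of \<open>A\<close>, respectively \<open>B\<close>, in dimension at least \<open>t\<close>. A subspace \<open>K\<close> of dimension less than \<open>r\<close>
  fails for some \<open>G \<in> B\<close>, so the members of \<open>A\<close> above \<open>K\<close> branch over fewer than \<open>q\<^bsup>b-t+1\<^esup>\<close> vectors
  of \<open>G\<close>. Starting from the \<open>t\<close>-subspaces of an optimal cover of \<open>A\<close>, of which there are at most
  \<open>q\<^bsup>(s-t)(t+1)\<^esup>\<close>, one bounds \<open>|A|\<close> and, symmetrically, \<open>|B|\<close>. In the product each unit of
  \<open>r - t\<close> costs less than \<open>q\<^bsup>b+2\<^esup>\<close>, whereas \<open>2\<nu> \<ge> 2a + b + 1\<close> makes every step from \<open>k\<close> to \<open>k + 1\<close>
  decrease the number of totally isotropic \<open>a\<close>-spaces above a \<open>k\<close>-space by a factor of at least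
  \<open>q\<^bsup>b+2\<^esup>\<close>. Hence equality forces \<open>r = s = t\<close>. For \<open>d > 2\<close> families the bounds for all pairs,
  combined with maximality of the full product, force equality in enough pairs.
\<close>

section \<open>Subspaces over a finite field: orders, dimensions and counting\<close>

lemma card_scalars_ge2: "2 \<le> CARD('a::{finite,field})"
proof -
  have "card {0, 1::'a} \<le> CARD('a)"
    by (rule card_mono) auto
  then show ?thesis by simp
qed

lemma subspace_scale_memD:
  assumes "vec.subspace (W :: ('a::field ^ 'n) set)" "c *s x \<in> W" "c \<noteq> 0"
  shows "x \<in> W"
  using vec.subspace_scale[OF assms(1,2), of "inverse c"] assms(3) by simp

lemma card_span_insert:
  fixes S :: "('a::{finite,field} ^ 'n) set"
  assumes "x \<notin> vec.span S"
  shows "card (vec.span (insert x S)) = CARD('a) * card (vec.span S)"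
proof -
  let ?h = "\<lambda>(c, y). c *s x + y"
  have inj: "inj_on ?h (UNIV \<times> vec.span S)"
  proof (intro inj_onI, clarsimp)
    fix c y c' y'
    assume y: "y \<in> vec.span S" "y' \<in> vec.span S" and e: "c *s x + y = c' *s x + y'"
    have "(c - c') *s x = y' - y"
      using e by (simp add: vec.scale_left_diff_distrib algebra_simps)
    then have "(c - c') *s x \<in> vec.span S"
      using y by (simp add: vec.span_diff)
    then have "c = c'"
      using assms subspace_scale_memD[of "vec.span S" "c - c'" x] by auto
    then show "c = c' \<and> y = y'" using e by simp
  qed
  have "vec.span (insert x S) = ?h ` (UNIV \<times> vec.span S)"
  proof (intro equalityI subsetI)
    fix z assume "z \<in> vec.span (insert x S)"
    then obtain k where "z - k *s x \<in> vec.span S"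
      by (auto simp: vec.span_insert)
    then show "z \<in> ?h ` (UNIV \<times> vec.span S)"
      by (intro image_eqI[where x = "(k, z - k *s x)"]) auto
  next
    fix z assume "z \<in> ?h ` (UNIV \<times> vec.span S)"
    then obtain c y where "z = c *s x + y" "y \<in> vec.span S" by auto
    then show "z \<in> vec.span (insert x S)"
      unfolding vec.span_insert by (auto intro: exI[of _ c])
  qed
  then show ?thesis
    using card_image[OF inj] by (simp add: card_cartesian_product)
qed

lemma card_subspace:
  fixes W :: "('a::{finite,field} ^ 'n) set"
  assumes "vec.subspace W"
  shows "card W = CARD('a) ^ vec.dim W"
proof -
  have *: "card (vec.span B) = CARD('a) ^ card B" if "vec.independent B" for B :: "('a ^ 'n) set"
    using finite[of B] that
  proof (induction B rule: finite_induct)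
    case (insert x B)
    then show ?case
      using card_span_insert[of x B] by (simp add: vec.independent_insert)
  qed simp
  obtain B where "B \<subseteq> W" "vec.independent B" "W \<subseteq> vec.span B" "card B = vec.dim W"
    using vec.basis_exists by blast
  then show ?thesis
    using *[of B] vec.span_subspace[OF _ _ assms, of B] by simp
qed

lemma dim_span_insert_subspace:
  assumes "vec.subspace (K :: ('a::field ^ 'n) set)" "x \<notin> K"
  shows "vec.dim (vec.span (insert x K)) = vec.dim K + 1"
proof -
  have "x \<notin> vec.span K" using assms vec.span_eq_iff by metis
  then show ?thesis by (simp add: vec.dim_insert)
qed

lemma dim_sums_Int_le:
  fixes U W F :: "('a::field ^ 'n) set"
  assumes "vec.subspace U" "vec.subspace W" "vec.subspace F" "U \<subseteq> F" "W \<subseteq> F"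
  shows "vec.dim U + vec.dim W \<le> vec.dim F + vec.dim (U \<inter> W)"
proof -
  have "{x + y |x y. x \<in> U \<and> y \<in> W} \<subseteq> F"
    using assms by (auto intro: vec.subspace_add)
  then have "vec.dim {x + y |x y. x \<in> U \<and> y \<in> W} \<le> vec.dim F"
    by (rule vec.dim_subset)
  then show ?thesis
    using vec.dim_sums_Int[OF assms(1,2)] by linarith
qed

text \<open>Greedy construction: while C is too small, C + (K \<inter> F) is proper in F, and
  adjoining any vector of F outside this sum keeps C disjoint from K except for 0.\<close>

lemma exists_subspace_avoiding:
  fixes F K :: "('a::field ^ 'n) set"
  assumes "vec.subspace F" "vec.subspace K" "j + vec.dim (K \<inter> F) \<le> vec.dim F"
  shows "\<exists>C. vec.subspace C \<and> C \<subseteq> F \<and> vec.dim C = j \<and> C \<inter> K = {0}"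
  using assms(3)
proof (induction j)
  case 0
  show ?case
    using assms by (intro exI[of _ "{0}"]) (auto simp: vec.subspace_0)
next
  case (Suc j)
  then obtain C where C: "vec.subspace C" "C \<subseteq> F" "vec.dim C = j" "C \<inter> K = {0}"
    by auto
  define D where "D = {x + y |x y. x \<in> C \<and> y \<in> K \<inter> F}"
  have KF: "vec.subspace (K \<inter> F)" using assms by (simp add: vec.subspace_inter)
  have D: "vec.subspace D" unfolding D_def by (rule vec.subspace_sums[OF C(1) KF])
  have "vec.dim D \<le> j + vec.dim (K \<inter> F)"
    using vec.dim_sums_Int[OF C(1) KF] C(3) unfolding D_def by linarith
  then have "vec.dim D < vec.dim F" using Suc.prems by simp
  then obtain x where x: "x \<in> F" "x \<notin> D"
    using vec.dim_subset[of F D] by fastforce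
  have CD: "C \<subseteq> D" unfolding D_def using vec.subspace_0[OF KF] by force
  let ?C = "vec.span (insert x C)"
  have "vec.dim ?C = Suc j"
    using dim_span_insert_subspace[OF C(1), of x] x CD C(3) by auto
  moreover have "?C \<subseteq> F"
    using x C(2) assms(1) by (intro vec.span_minimal) auto
  moreover have "?C \<inter> K \<subseteq> {0}"
  proof
    fix y assume y: "y \<in> ?C \<inter> K"
    have sC: "vec.span C = C" using C(1) by simp
    from y obtain k where k: "y - k *s x \<in> C"
      by (auto simp: vec.span_insert sC)
    have yF: "y \<in> F" using y \<open>?C \<subseteq> F\<close> by auto
    have "k = 0"
    proof (rule ccontr)
      assume "k \<noteq> 0"
      \<comment> \<open>The left side equals k x, so x itself would lie in \<open>D\<close>, against
        its choice.\<close>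
      have "- (y - k *s x) + y \<in> D"
        unfolding D_def using y yF vec.subspace_neg[OF C(1) k] by blast
      then show False
        using subspace_scale_memD[OF D, of k x] x \<open>k \<noteq> 0\<close> by simp
    qed
    then show "y \<in> {0}" using k y C(4) by auto
  qed
  ultimately show ?case
    using assms(2) by (intro exI[of _ ?C]) (auto simp: vec.span_zero vec.subspace_0)
qed

lemma card_subspace_Diff:
  fixes K F :: "('a::{finite,field} ^ 'n) set"
  assumes "vec.subspace K" "vec.subspace F" "K \<subseteq> F"
  shows "real (card (F - K)) = real CARD('a) ^ vec.dim F - real CARD('a) ^ vec.dim K"
  using assms card_mono[of F K] by (simp add: card_Diff_subset card_subspace of_nat_diff)

lemma span_insert_subset_iff:
  assumes "vec.subspace (F :: ('a::field ^ 'n) set)"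
  shows "vec.span (insert x K) \<subseteq> F \<longleftrightarrow> x \<in> F \<and> K \<subseteq> F"
  using vec.span_minimal[OF _ assms, of "insert x K"] vec.span_superset[of "insert x K"] by auto

text \<open>Counts the pairs \<open>(x, F)\<close> with \<open>x \<in> F - K\<close> in two ways; this yields the numbers of subspaces
  of a vector space as well as the numbers of totally isotropic subspaces.\<close>

lemma card_subspaces_above:
  fixes P :: "('a::{finite,field} ^ 'n) set \<Rightarrow> bool" and e :: "nat \<Rightarrow> nat" and m :: nat
  defines "q \<equiv> real CARD('a)"
  assumes subspace: "\<And>W. P W \<Longrightarrow> vec.subspace W"
    and down: "\<And>U W. P W \<Longrightarrow> vec.subspace U \<Longrightarrow> U \<subseteq> W \<Longrightarrow> P U"
    and ext: "\<And>K. P K \<Longrightarrow> vec.dim K < m \<Longrightarrow>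
      real (card {x. x \<notin> K \<and> P (vec.span (insert x K))}) = q ^ e (vec.dim K) - q ^ vec.dim K"
    and K: "P K" "vec.dim K \<le> m"
  shows "real (card {F. P F \<and> vec.dim F = m \<and> K \<subseteq> F}) =
    (\<Prod>i = vec.dim K..<m. (q ^ e i - q ^ i) / (q ^ m - q ^ i))"
  using K
proof (induction "m - vec.dim K" arbitrary: K)
  case 0
  then have "vec.dim K = m" by simp
  moreover have "F = K" if "P F" "vec.dim F = m" "K \<subseteq> F" for F
    using vec.subspace_dim_equal[of K F] that \<open>P K\<close> \<open>vec.dim K = m\<close> subspace by simp
  ultimately have "{F. P F \<and> vec.dim F = m \<and> K \<subseteq> F} = {K}"
    using \<open>P K\<close> by auto
  then show ?case using \<open>vec.dim K = m\<close> by simp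
next
  case (Suc j)
  define k where "k = vec.dim K"
  have km: "k < m" using Suc.hyps(2) k_def by simp
  define X where "X = {F. P F \<and> vec.dim F = m \<and> K \<subseteq> F}"
  define Y where "Y = {x. x \<notin> K \<and> P (vec.span (insert x K))}"
  define p where "p = (\<Prod>i = Suc k..<m. (q ^ e i - q ^ i) / (q ^ m - q ^ i))"
  have sK: "vec.subspace K" using subspace Suc.prems by simp
  have 1: "real (card {x \<in> Y. x \<in> F}) = q ^ m - q ^ k" if "F \<in> X" for F
  proof -
    have F: "P F" "vec.dim F = m" "K \<subseteq> F" using that by (auto simp: X_def)
    \<comment> \<open>As \<open>P\<close> passes to subspaces, every vector of F outside K may be
      adjoined to K.\<close>
    have "{x \<in> Y. x \<in> F} = F - K"
      using F down[OF F(1)] by (auto simp: Y_def span_insert_subset_iff subspace)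
    then show ?thesis
      using card_subspace_Diff[OF sK subspace[OF F(1)] F(3)] F by (simp add: q_def k_def)
  qed
  have 2: "real (card {F \<in> X. x \<in> F}) = p" if "x \<in> Y" for x
  proof -
    let ?K = "vec.span (insert x K)"
    have x: "x \<notin> K" "P ?K" using that by (auto simp: Y_def)
    have dim: "vec.dim ?K = Suc k"
      using dim_span_insert_subspace[OF sK x(1)] by (simp add: k_def del: vec.dim_span)
    have "{F \<in> X. x \<in> F} = {F. P F \<and> vec.dim F = m \<and> ?K \<subseteq> F}"
    proof (rule set_eqI)
      fix F show "F \<in> {F \<in> X. x \<in> F} \<longleftrightarrow> F \<in> {F. P F \<and> vec.dim F = m \<and> ?K \<subseteq> F}"
        by (cases "P F") (auto simp only: X_def span_insert_subset_iff[OF subspace] mem_Collect_eq)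
    qed
    moreover have "real (card {F. P F \<and> vec.dim F = m \<and> ?K \<subseteq> F}) = p"
      using Suc.hyps(1)[of ?K] Suc.hyps(2) x km unfolding dim p_def k_def[symmetric] by simp
    ultimately show ?thesis by simp
  qed
  have "(\<Sum>F\<in>X. card {x \<in> Y. x \<in> F}) = (\<Sum>x\<in>Y. card {F \<in> X. x \<in> F})"
    by (rule sum_multicount_gen) auto
  from arg_cong[OF this, of real]
  have "(\<Sum>F\<in>X. real (card {x \<in> Y. x \<in> F})) = (\<Sum>x\<in>Y. real (card {F \<in> X. x \<in> F}))"
    by (simp only: of_nat_sum)
  then have "real (card X) * (q ^ m - q ^ k) = real (card Y) * p"
    using 1 2 by simp
  moreover have "real (card Y) = q ^ e k - q ^ k"
    using ext[of K] Suc.prems km by (simp add: Y_def k_def)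
  moreover have "q ^ k < q ^ m"
    using km card_scalars_ge2[where 'a = 'a] by (simp add: q_def)
  ultimately have "real (card X) = (q ^ e k - q ^ k) / (q ^ m - q ^ k) * p"
    by (simp add: eq_divide_eq)
  then show ?case
    unfolding X_def k_def[symmetric] p_def using km by (simp add: prod.atLeast_Suc_lessThan)
qed

section \<open>Gaussian binomials and the counts of totally isotropic subspaces\<close>

text \<open>The Gaussian binomial coefficient: independent t-tuples of an s-space, divided by those
  of a t-space.\<close>

definition subspace_count :: "nat \<Rightarrow> nat \<Rightarrow> nat \<Rightarrow> real" where
  "subspace_count q s t = (\<Prod>i<t. (real q ^ s - real q ^ i) / (real q ^ t - real q ^ i))"

lemma subspace_count_pos:
  assumes "2 \<le> q" "t \<le> s"
  shows "0 < subspace_count q s t"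
  using assms by (auto simp: subspace_count_def intro!: prod_pos divide_pos_pos)

lemma subspace_count_self:
  assumes "2 \<le> q"
  shows "subspace_count q t t = 1"
  using assms by (auto simp: subspace_count_def intro!: prod.neutral)

lemma card_subspaces_of_dim:
  fixes S :: "('a::{finite,field} ^ 'n) set"
  assumes S: "vec.subspace S" and t: "t \<le> vec.dim S"
  shows "real (card {T. vec.subspace T \<and> T \<subseteq> S \<and> vec.dim T = t}) =
    subspace_count CARD('a) (vec.dim S) t"
proof -
  let ?P = "\<lambda>W. vec.subspace W \<and> W \<subseteq> S"
  let ?q = "real CARD('a)"
  \<comment> \<open>All vectors of S outside K are admissible, whence the constant exponent
    \<open>vec.dim S\<close>.\<close>
  have "real (card {x. x \<notin> K \<and> ?P (vec.span (insert x K))}) = ?q ^ vec.dim S - ?q ^ vec.dim K"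
    if "?P K" for K
  proof -
    have "{x. x \<notin> K \<and> ?P (vec.span (insert x K))} = S - K"
      using that span_insert_subset_iff[OF S] by auto
    then show ?thesis using card_subspace_Diff[of K S] that S by simp
  qed
  then have "real (card {F. ?P F \<and> vec.dim F = t \<and> {0} \<subseteq> F}) =
    (\<Prod>i = vec.dim ({0} :: ('a ^ 'n) set)..<t. (?q ^ vec.dim S - ?q ^ i) / (?q ^ t - ?q ^ i))"
    using S by (intro card_subspaces_above[where P = ?P and e = "\<lambda>_. vec.dim S"])
      (auto simp: vec.subspace_0)
  moreover have "{F. ?P F \<and> vec.dim F = t \<and> {0} \<subseteq> F} =
    {T. vec.subspace T \<and> T \<subseteq> S \<and> vec.dim T = t}"
    by (auto simp: vec.subspace_0)
  ultimately show ?thesis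
    by (simp add: subspace_count_def atLeast0LessThan)
qed

text \<open>The value is 1 at s = t, and raising s by one multiplies it by (q^(s+1) - 1) /
  (q^(s-t+1) - 1), which is at most q^(t+1) because q is at least 2.\<close>

lemma subspace_count_le:
  assumes q: "2 \<le> q"
  shows "subspace_count q (t + u) t \<le> real q ^ (u * (t + 1))"
proof (cases t)
  case 0
  then show ?thesis using q by (simp add: subspace_count_def)
next
  case (Suc t')
  define Q where "Q s = (\<Prod>i<t. real q ^ s - real q ^ i)" for s
  have pos: "0 < Q s" if "t \<le> s" for s
    using that q by (auto simp: Q_def intro!: prod_pos)
  have "Q (t + u) \<le> real q ^ (u * (t + 1)) * Q t"
  proof (induction u)
    case (Suc u)
    let ?s = "t + u"
    have d: "0 < real q ^ ?s - real q ^ t'"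
      using q \<open>t = Suc t'\<close> power_strict_increasing[of t' ?s "real q"] by simp
    \<comment> \<open>For i > 0 the factors of \<open>Q (Suc ?s)\<close> are q times those of
      \<open>Q ?s\<close> with index i - 1. The factor of \<open>Q ?s\<close> with index t' is left
      over; multiplying by it avoids a division.\<close>
    have "Q (Suc ?s) * (real q ^ ?s - real q ^ t') =
       (real q ^ Suc ?s - 1) * real q ^ t' * Q ?s"
    proof -
      let ?A = "\<Prod>i<t'. real q ^ ?s - real q ^ i"
      have "(\<Prod>i<t'. real q ^ Suc ?s - real q ^ Suc i) =
        (\<Prod>i<t'. real q * (real q ^ ?s - real q ^ i))"
        by (simp add: algebra_simps)
      also have "\<dots> = real q ^ t' * ?A"
        by (simp add: prod.distrib)
      finally have "Q (Suc ?s) = (real q ^ Suc ?s - 1) * (real q ^ t' * ?A)"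
        unfolding Q_def \<open>t = Suc t'\<close> by (simp only: prod.lessThan_Suc_shift power_0)
      moreover have "Q ?s = ?A * (real q ^ ?s - real q ^ t')"
        unfolding Q_def \<open>t = Suc t'\<close> by (simp only: prod.lessThan_Suc)
      ultimately show ?thesis by simp
    qed
    also have "\<dots> \<le> real q ^ (t + 1) * (real q ^ ?s - real q ^ t') * Q ?s"
    proof (rule mult_right_mono)
      have "2 * real q ^ Suc ?s \<le> real q * real q ^ Suc ?s" "real q ^ (t + 1) \<le> real q ^ Suc ?s"
        using q by (auto intro!: mult_right_mono power_increasing)
      moreover have "real q * real q ^ Suc ?s = real q ^ (t + 1) * real q ^ Suc u"
        by (simp add: power_add)
      ultimately have "real q ^ Suc ?s - 1 \<le> real q ^ (t + 1) * (real q ^ Suc u - 1)"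
        unfolding right_diff_distrib by linarith
      then have "(real q ^ Suc ?s - 1) * real q ^ t'
        \<le> real q ^ (t + 1) * (real q ^ Suc u - 1) * real q ^ t'"
        by (intro mult_right_mono) auto
      also have "\<dots> = real q ^ (t + 1) * (real q ^ ?s - real q ^ t')"
        by (simp add: \<open>t = Suc t'\<close> power_add algebra_simps)
      finally show "(real q ^ Suc ?s - 1) * real q ^ t'
        \<le> real q ^ (t + 1) * (real q ^ ?s - real q ^ t')" .
      show "0 \<le> Q ?s" using pos[of ?s] by simp
    qed
    finally have "Q (Suc ?s) \<le> real q ^ (t + 1) * Q ?s"
      using d by (simp add: mult.commute mult.left_commute mult_le_cancel_left)
    also have "\<dots> \<le> real q ^ (t + 1) * (real q ^ (u * (t + 1)) * Q t)"
      using Suc.IH by (intro mult_left_mono) auto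
    finally show ?case by (simp add: power_add algebra_simps)
  qed simp
  then show ?thesis
    using pos[of t] by (simp add: subspace_count_def prod_dividef Q_def divide_simps)
qed

text \<open>The number of totally isotropic m-spaces containing a given one of dimension k, in a
  symplectic space of dimension n. An i-dimensional one is extended by vectors of its perpendicular
  space lying outside it, whence q^(n-i) - q^i.\<close>

definition TI_count :: "nat \<Rightarrow> nat \<Rightarrow> nat \<Rightarrow> nat \<Rightarrow> real" where
  "TI_count q n m k = (\<Prod>i = k..<m. (real q ^ (n - i) - real q ^ i) / (real q ^ m - real q ^ i))"

lemma TI_count_pos:
  assumes "2 \<le> q" "2 * m \<le> n"
  shows "0 < TI_count q n m k"
  using assms by (auto simp: TI_count_def intro!: prod_pos divide_pos_pos)

text \<open>The factor lost is (q^(n-k) - q^k) / (q^m - q^k). Since k is at most m - 1, n - k is at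
  least m + l + 2: this turns the l + 1 of the hypothesis into l + 2.\<close>

lemma TI_count_Suc_le:
  assumes q: "2 \<le> q" and "k < m" and n: "2 * m + l + 1 \<le> n"
  shows "real q ^ (l + 2) * TI_count q n m (Suc k) \<le> TI_count q n m k"
proof -
  have d: "0 < real q ^ m - real q ^ k"
    using q \<open>k < m\<close> by simp
  have "real q ^ (l + 2 + m) \<le> real q ^ (n - k)"
    using q assms by (intro power_increasing) auto
  moreover have "1 * real q ^ k \<le> real q ^ (l + 2) * real q ^ k"
    using q one_le_power[of "real q" "l + 2"] by (intro mult_right_mono) auto
  ultimately have "real q ^ (l + 2) * (real q ^ m - real q ^ k) \<le> real q ^ (n - k) - real q ^ k"
    by (simp only: power_add right_diff_distrib)
  then have "real q ^ (l + 2) \<le> (real q ^ (n - k) - real q ^ k) / (real q ^ m - real q ^ k)"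
    using d by (simp add: le_divide_eq)
  then have "real q ^ (l + 2) * TI_count q n m (Suc k) \<le>
    (real q ^ (n - k) - real q ^ k) / (real q ^ m - real q ^ k) * TI_count q n m (Suc k)"
    using TI_count_pos[of q m n "Suc k"] q n by (intro mult_right_mono) auto
  then show ?thesis
    using \<open>k < m\<close> by (simp add: TI_count_def prod.atLeast_Suc_lessThan)
qed

lemma TI_count_add_le:
  assumes "2 \<le> q" "k + u \<le> m" "2 * m + l + 1 \<le> n"
  shows "real q ^ ((l + 2) * u) * TI_count q n m (k + u) \<le> TI_count q n m k"
  using assms(2)
proof (induction u)
  case (Suc u)
  have "real q ^ ((l + 2) * Suc u) * TI_count q n m (k + Suc u) =
    real q ^ ((l + 2) * u) * (real q ^ (l + 2) * TI_count q n m (Suc (k + u)))"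
    by (simp add: power_add)
  also have "\<dots> \<le> real q ^ ((l + 2) * u) * TI_count q n m (k + u)"
    using TI_count_Suc_le[OF assms(1) _ assms(3), of "k + u"] Suc.prems
    by (intro mult_left_mono) auto
  also have "\<dots> \<le> TI_count q n m k" using Suc by simp
  finally show ?case .
qed simp

section \<open>Symplectic spaces: perpendicular subspaces and totally isotropic extensions\<close>

locale symplectic_space =
  fixes f :: "'a::{finite,field} ^ 'n \<Rightarrow> 'a ^ 'n \<Rightarrow> 'a"
  assumes bilinear: "bilinear_form f"
    and alternating: "alternating_form f"
    and nondegenerate: "nondegenerate_form f"
begin

lemma form_add_left: "f (x + y) z = f x z + f y z"
  and form_add_right: "f x (y + z) = f x y + f x z"
  and form_scale_left: "f (c *s x) y = c * f x y"
  and form_scale_right: "f x (c *s y) = c * f x y"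
  using bilinear unfolding bilinear_form_def by blast+

lemma form_self [simp]: "f x x = 0"
  using alternating unfolding alternating_form_def by blast

lemma form_zero_left [simp]: "f 0 x = 0" and form_zero_right [simp]: "f x 0 = 0"
  using form_scale_left[of 0 0 x] form_scale_right[of x 0 0] by auto

lemma form_diff_right: "f x (y - z) = f x y - f x z"
  using form_add_right[of x "y - z" z] by (simp add: algebra_simps)

lemma form_swap: "f y x = - f x y"
  using form_self[of "x + y"] by (simp add: form_add_left form_add_right del: form_self) (simp add: add_eq_0_iff)

definition perp :: "('a ^ 'n) set \<Rightarrow> ('a ^ 'n) set" where
  "perp K = {x. \<forall>y\<in>K. f x y = 0}"

lemma subspace_perp: "vec.subspace (perp K)"
  by (rule vec.subspaceI) (auto simp: perp_def form_add_left form_scale_left)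

text \<open>The functional \<open>f x\<close> does not vanish on K, so its kernel in K is a
  hyperplane, complemented by the line through z.\<close>

lemma card_kernel:
  assumes K: "vec.subspace K" and "z \<in> K" "f x z \<noteq> 0"
  shows "card K = CARD('a) * card {y \<in> K. f x y = 0}"
proof -
  let ?H = "{y \<in> K. f x y = 0}"
  have H: "vec.subspace ?H"
    using K by (auto intro!: vec.subspaceI simp: form_add_right form_scale_right
      vec.subspace_0 vec.subspace_add vec.subspace_scale)
  then have sH: "vec.span ?H = ?H" by (rule vec.span_eq_iff[THEN iffD2])
  have "vec.span (insert z ?H) = K"
  proof
    show "vec.span (insert z ?H) \<subseteq> K"
      using K assms(2) by (intro vec.span_minimal) auto
    show "K \<subseteq> vec.span (insert z ?H)"
    proof
      fix y assume "y \<in> K"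
      then have "y - (f x y / f x z) *s z \<in> ?H"
        using assms by (auto simp: form_diff_right form_scale_right vec.subspace_diff vec.subspace_scale)
      then show "y \<in> vec.span (insert z ?H)"
        unfolding vec.span_insert sH by blast
    qed
  qed
  moreover have "z \<notin> vec.span ?H" unfolding sH using assms by simp
  ultimately show ?thesis
    using card_span_insert[of z ?H] sH by simp
qed

text \<open>Counting the pairs \<open>(x, y)\<close> with \<open>y \<in> K\<close> and \<open>f x y = 0\<close> in two ways avoids dual spaces.\<close>

lemma card_perp:
  assumes K: "vec.subspace K"
  shows "card (perp K) * card K = CARD('a) ^ CARD('n)"
proof -
  let ?q = "real CARD('a)"
  let ?V = "UNIV :: ('a ^ 'n) set"
  \<comment> \<open>The factor q avoids division: for x outside \<open>perp K\<close> the kernel has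
    index q in K.\<close>
  have row: "?q * real (card {y \<in> K. f x y = 0}) =
      (if x \<in> perp K then ?q * card K else card K)" for x
  proof (cases "x \<in> perp K")
    case True
    then have "{y \<in> K. f x y = 0} = K" by (auto simp: perp_def)
    then show ?thesis using True by simp
  next
    case False
    then obtain z where "z \<in> K" "f x z \<noteq> 0" by (auto simp: perp_def)
    from card_kernel[OF K this] show ?thesis using False by simp
  qed
  \<comment> \<open>Nondegeneracy enters here: only y = 0 is orthogonal to the whole space.\<close>
  have column: "?q * real (card {x \<in> ?V. f x y = 0}) =
      (if y = 0 then ?q * card ?V else card ?V)" for y
  proof (cases "y = 0")
    case False
    then obtain z where "f y z \<noteq> 0"
      using nondegenerate unfolding nondegenerate_form_def by blast
    moreover have "{x \<in> ?V. f x y = 0} = {x \<in> ?V. f y x = 0}"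
      using form_swap by (metis neg_equal_0_iff_equal)
    ultimately show ?thesis
      using card_kernel[of ?V z y] False by simp
  qed simp
  have "(\<Sum>x\<in>?V. card {y \<in> K. f x y = 0}) = (\<Sum>y\<in>K. card {x \<in> ?V. f x y = 0})"
    by (rule sum_multicount_gen) auto
  from arg_cong[OF this, of "\<lambda>n. ?q * real n"]
  have "(\<Sum>x\<in>?V. ?q * real (card {y \<in> K. f x y = 0})) =
      (\<Sum>y\<in>K. ?q * real (card {x \<in> ?V. f x y = 0}))"
    by (simp only: of_nat_sum sum_distrib_left)
  then have "(\<Sum>x\<in>?V. if x \<in> perp K then ?q * card K else card K) =
      (\<Sum>y\<in>K. if y = 0 then ?q * card ?V else card ?V)"
    by (simp only: row column)
  \<comment> \<open>With the constant summands split off, both sides contain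
    \<open>card ?V * card K\<close>; cancelling it leaves q - 1 times the claim.\<close>
  moreover have "(\<Sum>x\<in>?V. if x \<in> perp K then ?q * card K else card K) =
      (\<Sum>x\<in>?V. real (card K)) + (\<Sum>x\<in>?V. if x \<in> perp K then (?q - 1) * card K else 0)"
    unfolding sum.distrib[symmetric] by (rule sum.cong) (auto simp: algebra_simps)
  moreover have "(\<Sum>y\<in>K. if y = 0 then ?q * card ?V else card ?V) =
      (\<Sum>y\<in>K. real (card ?V)) + (\<Sum>y\<in>K. if y = 0 then (?q - 1) * card ?V else 0)"
    unfolding sum.distrib[symmetric] by (rule sum.cong) (auto simp: algebra_simps)
  moreover have "(\<Sum>x\<in>?V. if x \<in> perp K then (?q - 1) * card K else 0) =
      (?q - 1) * (real (card (perp K)) * real (card K))"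
    by (simp add: sum.If_cases)
  moreover have "(\<Sum>y\<in>K. if y = 0 then (?q - 1) * card ?V else 0) = (?q - 1) * real (card ?V)"
    using vec.subspace_0[OF K] by simp
  ultimately have "(?q - 1) * (real (card (perp K)) * real (card K)) = (?q - 1) * real (card ?V)"
    by simp
  moreover have "?q - 1 \<noteq> 0"
    using card_scalars_ge2[where 'a = 'a] by simp
  ultimately have "real (card (perp K) * card K) = real (card ?V)"
    by simp
  then show ?thesis
    by (simp only: of_nat_eq_iff) simp
qed

lemma dim_perp:
  assumes K: "vec.subspace K"
  shows "vec.dim (perp K) + vec.dim K = CARD('n)"
proof -
  have "CARD('a) ^ (vec.dim (perp K) + vec.dim K) = CARD('a) ^ CARD('n)"
    using card_perp[OF K] card_subspace[OF K] card_subspace[OF subspace_perp[of K]]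
    by (simp add: power_add)
  then show ?thesis
    using card_scalars_ge2[where 'a = 'a] by simp
qed

lemma totally_isotropic_subset:
  "totally_isotropic f W \<Longrightarrow> vec.subspace U \<Longrightarrow> U \<subseteq> W \<Longrightarrow> totally_isotropic f U"
  unfolding totally_isotropic_def by blast

text \<open>The form being alternating, x is orthogonal to itself, so only its products with K
  matter. Thus the admissible vectors form a subspace of known order.\<close>

lemma totally_isotropic_span_insert_iff:
  assumes K: "totally_isotropic f K"
  shows "totally_isotropic f (vec.span (insert x K)) \<longleftrightarrow> x \<in> perp K"
proof
  assume "totally_isotropic f (vec.span (insert x K))"
  then show "x \<in> perp K"
    unfolding totally_isotropic_def perp_def by (auto intro: vec.span_base)
next
  assume x: "x \<in> perp K"
  have sK: "vec.span K = K"
    using K unfolding totally_isotropic_def by simp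
  have 1: "f z y = 0" if "y \<in> vec.span (insert x K)" "z \<in> insert x K" for y z
  proof -
    from that(1) obtain k where k: "y - k *s x \<in> K" by (auto simp: vec.span_insert sK)
    have "f z (y - k *s x) = 0"
      using that(2) k x K unfolding perp_def totally_isotropic_def by blast
    moreover have "f z x = 0"
      using that(2) x form_swap[of x z] by (auto simp: perp_def)
    ultimately show ?thesis by (simp add: form_diff_right form_scale_right)
  qed
  \<comment> \<open>The vectors orthogonal to the whole span form a subspace, so testing the
    generators suffices.\<close>
  have "vec.span (insert x K) \<subseteq> {z. \<forall>y\<in>vec.span (insert x K). f z y = 0}"
    using subspace_perp[of "vec.span (insert x K)"] 1
    unfolding perp_def by (intro vec.span_minimal) auto
  then show "totally_isotropic f (vec.span (insert x K))"
    unfolding totally_isotropic_def by auto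
qed

lemma card_TI_above:
  assumes "totally_isotropic f K" "vec.dim K \<le> m"
  shows "real (card {F \<in> TI_subspaces f m. K \<subseteq> F}) = TI_count CARD('a) CARD('n) m (vec.dim K)"
proof -
  let ?q = "real CARD('a)"
  have "real (card {x. x \<notin> K \<and> totally_isotropic f (vec.span (insert x K))}) =
      ?q ^ (CARD('n) - vec.dim K) - ?q ^ vec.dim K" if K: "totally_isotropic f K" for K
  proof -
    have sK: "vec.subspace K" using K by (simp add: totally_isotropic_def)
    have "{x. x \<notin> K \<and> totally_isotropic f (vec.span (insert x K))} = perp K - K"
      using totally_isotropic_span_insert_iff[OF K] by auto
    moreover have "K \<subseteq> perp K" using K by (auto simp: totally_isotropic_def perp_def)
    moreover have "vec.dim (perp K) = CARD('n) - vec.dim K" using dim_perp[OF sK] by simp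
    ultimately show ?thesis
      using card_subspace_Diff[OF sK subspace_perp] by simp
  qed
  then have "real (card {F. totally_isotropic f F \<and> vec.dim F = m \<and> K \<subseteq> F}) =
      (\<Prod>i = vec.dim K..<m. (?q ^ (CARD('n) - i) - ?q ^ i) / (?q ^ m - ?q ^ i))"
    using assms totally_isotropic_subset
    by (intro card_subspaces_above[where P = "totally_isotropic f" and e = "\<lambda>i. CARD('n) - i"])
      (auto simp: totally_isotropic_def)
  then show ?thesis
    by (simp add: TI_count_def TI_subspaces_def conj_assoc)
qed

end

section \<open>Branching and covers\<close>

text \<open>Inside \<open>G\<close> choose \<open>C\<close> of dimension \<open>b - t + 1\<close> with \<open>C \<inter> K = 0\<close>: every \<open>F\<close> in the family meets
  \<open>G\<close> in dimension at least \<open>t\<close> and hence contains a nonzero vector of \<open>C\<close>.\<close>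

lemma card_above_branch:
  fixes K G :: "('a::{finite,field} ^ 'n) set"
  assumes K: "vec.subspace K" and G: "vec.subspace G" and KG: "vec.dim (K \<inter> G) < t"
    and t: "t \<le> vec.dim G"
    and A: "\<And>F. F \<in> A \<Longrightarrow> vec.subspace F \<and> t \<le> vec.dim (F \<inter> G)"
    and c: "\<And>x. x \<notin> K \<Longrightarrow> real (card {F \<in> A. vec.span (insert x K) \<subseteq> F}) \<le> c"
  shows "real (card {F \<in> A. K \<subseteq> F}) \<le> (real CARD('a) ^ (vec.dim G - t + 1) - 1) * c"
proof -
  have "vec.dim G - t + 1 + vec.dim (K \<inter> G) \<le> vec.dim G" using KG t by linarith
  from exists_subspace_avoiding[OF G K this]
  obtain C where C: "vec.subspace C" "C \<subseteq> G" "vec.dim C = vec.dim G - t + 1" "C \<inter> K = {0}"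
    by blast
  have "{F \<in> A. K \<subseteq> F} \<subseteq> (\<Union>x\<in>C - {0}. {F \<in> A. vec.span (insert x K) \<subseteq> F})"
  proof
    fix F assume F: "F \<in> {F \<in> A. K \<subseteq> F}"
    then have sF: "vec.subspace F" and "t \<le> vec.dim (F \<inter> G)" using A by auto
    \<comment> \<open>Inside G, the dimensions of F \<inter> G and C add up to more than that of
      G.\<close>
    moreover have "vec.dim (F \<inter> G) + vec.dim C \<le> vec.dim G + vec.dim (F \<inter> G \<inter> C)"
      using sF C(1,2) G by (intro dim_sums_Int_le vec.subspace_inter) auto
    ultimately have "vec.dim (F \<inter> G \<inter> C) \<noteq> 0" using C(3) t by linarith
    then obtain x where "x \<in> F \<inter> G \<inter> C" "x \<noteq> 0" by (auto simp del: Int_iff)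
    then show "F \<in> (\<Union>x\<in>C - {0}. {F \<in> A. vec.span (insert x K) \<subseteq> F})"
      using F span_insert_subset_iff[OF sF] by auto
  qed
  then have "card {F \<in> A. K \<subseteq> F} \<le> card (\<Union>x\<in>C - {0}. {F \<in> A. vec.span (insert x K) \<subseteq> F})"
    by (intro card_mono) auto
  also have "\<dots> \<le> (\<Sum>x\<in>C - {0}. card {F \<in> A. vec.span (insert x K) \<subseteq> F})"
    by (rule card_UN_le) simp
  finally have "real (card {F \<in> A. K \<subseteq> F}) \<le>
      (\<Sum>x\<in>C - {0}. real (card {F \<in> A. vec.span (insert x K) \<subseteq> F}))"
    by (simp only: of_nat_le_iff flip: of_nat_sum)
  also have "\<dots> \<le> (\<Sum>x\<in>C - {0}. c)"
    using C(4) by (intro sum_mono c) auto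
  \<comment> \<open>Nonzero vectors are counted instead of lines; the subtracted 1 later makes the
    comparison strict.\<close>
  also have "\<dots> = (real CARD('a) ^ (vec.dim G - t + 1) - 1) * c"
    using card_subspace_Diff[OF vec.subspace_single_0 C(1)] C(3) vec.subspace_0[OF C(1)]
    by simp
  finally show ?thesis .
qed

text \<open>Covers are arbitrary subspaces, not only totally isotropic ones, so every span arising
  in the branching can be compared with them.\<close>

definition covers :: "nat \<Rightarrow> ('a::field ^ 'n) set set \<Rightarrow> ('a ^ 'n) set \<Rightarrow> bool" where
  "covers t A S \<longleftrightarrow> vec.subspace S \<and> (\<forall>F\<in>A. t \<le> vec.dim (S \<inter> F))"

definition cover_number :: "nat \<Rightarrow> ('a::field ^ 'n) set set \<Rightarrow> nat" where
  "cover_number t A = (LEAST r. \<exists>S. covers t A S \<and> vec.dim S = r)"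

lemma cover_number_le: "covers t A S \<Longrightarrow> cover_number t A \<le> vec.dim S"
  unfolding cover_number_def by (rule Least_le) blast

lemma obtain_minimal_cover:
  assumes "covers t A S"
  obtains S' where "covers t A S'" "vec.dim S' = cover_number t A"
  using LeastI_ex[of "\<lambda>r. \<exists>S. covers t A S \<and> vec.dim S = r"] assms
  unfolding cover_number_def by blast

lemma le_dim_cover: "covers t A S \<Longrightarrow> A \<noteq> {} \<Longrightarrow> t \<le> vec.dim S"
  unfolding covers_def using vec.dim_subset[of "S \<inter> _" S] by (meson Int_lower1 all_not_in_conv order_trans)

definition cross_intersecting :: "nat \<Rightarrow> ('a::field ^ 'n) set set \<Rightarrow> ('a ^ 'n) set set \<Rightarrow> bool" where
  "cross_intersecting t A B \<longleftrightarrow> (\<forall>F\<in>A. \<forall>G\<in>B. t \<le> vec.dim (F \<inter> G))"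

lemma cross_intersecting_commute: "cross_intersecting t A B \<longleftrightarrow> cross_intersecting t B A"
  unfolding cross_intersecting_def by (metis Int_commute)

text \<open>The starting t-spaces contribute exponent u(t+1), the branching less than u(b-t+1). The
  sum u(b+2) is what u steps of \<open>TI_count\<close> gain back. Strictness comes from the
  subtracted 1, as u > 0.\<close>

lemma branching_bound_less:
  assumes q: "2 \<le> q" and u: "0 < u" "t + u \<le> a" and "t \<le> b" and n: "2 * a + b + 1 \<le> n"
  shows "subspace_count q (t + u) t * ((real q ^ (b - t + 1) - 1) ^ u * TI_count q n a (t + u))
    < TI_count q n a t"
proof -
  have N: "0 < TI_count q n a (t + u)" using TI_count_pos q n by simp
  have "1 \<le> real q ^ (b - t + 1)" using q by (intro one_le_power) simp
  then have p: "(real q ^ (b - t + 1) - 1) ^ u < (real q ^ (b - t + 1)) ^ u"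
    using u by (intro power_strict_mono) auto
  have "subspace_count q (t + u) t * ((real q ^ (b - t + 1) - 1) ^ u * TI_count q n a (t + u))
    \<le> real q ^ (u * (t + 1)) * ((real q ^ (b - t + 1) - 1) ^ u * TI_count q n a (t + u))"
    using subspace_count_le[OF q] N \<open>1 \<le> _\<close> by (intro mult_right_mono) auto
  also have "\<dots> < real q ^ (u * (t + 1)) * ((real q ^ (b - t + 1)) ^ u * TI_count q n a (t + u))"
    using p N q by (intro mult_strict_left_mono mult_strict_right_mono) auto
  also have "\<dots> = real q ^ ((b + 2) * u) * TI_count q n a (t + u)"
  proof -
    have "u * (t + 1) + (b - t + 1) * u = (b + 2) * u"
      using \<open>t \<le> b\<close> by (auto simp: algebra_simps dest!: le_Suc_ex)
    then have "real q ^ (u * (t + 1)) * (real q ^ (b - t + 1)) ^ u = real q ^ ((b + 2) * u)"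
      by (metis power_add power_mult)
    then show ?thesis by (simp only: mult.assoc[symmetric])
  qed
  also have "\<dots> \<le> TI_count q n a t"
    by (rule TI_count_add_le[OF q u(2) n])
  finally show ?thesis .
qed

section \<open>Bounding one family by means of the covering number of the other\<close>

context symplectic_space
begin

abbreviation star :: "nat \<Rightarrow> ('a ^ 'n) set \<Rightarrow> ('a ^ 'n) set set" where
  "star m T \<equiv> {F \<in> TI_subspaces f m. T \<subseteq> F}"

lemma TI_subspacesD:
  "F \<in> TI_subspaces f m \<Longrightarrow> vec.subspace F \<and> totally_isotropic f F \<and> vec.dim F = m"
  by (simp add: TI_subspaces_def totally_isotropic_def)

lemma TI_count_CARD_pos: "2 * m \<le> CARD('n) \<Longrightarrow> 0 < TI_count CARD('a) CARD('n) m k"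
  using TI_count_pos card_scalars_ge2 by blast

lemma card_above_le_TI_count:
  assumes A: "A \<subseteq> TI_subspaces f a" and a: "2 * a \<le> CARD('n)" and K: "vec.subspace K"
  shows "real (card {F \<in> A. K \<subseteq> F}) \<le> TI_count CARD('a) CARD('n) a (vec.dim K)"
proof (cases "{F \<in> A. K \<subseteq> F} = {}")
  case False
  then obtain F where F: "F \<in> TI_subspaces f a" "K \<subseteq> F" using A by auto
  then have "totally_isotropic f K" "vec.dim K \<le> a"
    using totally_isotropic_subset[of F K] K vec.dim_subset[of K F] TI_subspacesD by auto
  moreover have "card {F \<in> A. K \<subseteq> F} \<le> card (star a K)"
    using A by (intro card_mono) auto
  ultimately show ?thesis
    using card_TI_above[of K a] by simp
next
  case True
  \<comment> \<open>No member contains K, for instance because K is not isotropic: 0 is compared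
    with a positive number.\<close>
  then show ?thesis
    using TI_count_CARD_pos[OF a, of "vec.dim K"] by (simp only: card.empty)
qed

text \<open>Induction on the deficit u. A subspace smaller than the covering number of B fails for
  some G in B; branching over G raises its dimension by one. At deficit 0 the plain count
  applies.\<close>

lemma card_above_le:
  assumes A: "A \<subseteq> TI_subspaces f a" and B: "B \<subseteq> TI_subspaces f b"
    and cross: "cross_intersecting t A B" and "t \<le> b" and a: "2 * a \<le> CARD('n)"
    and K: "vec.subspace K" "vec.dim K + u = cover_number t B"
  shows "real (card {F \<in> A. K \<subseteq> F}) \<le>
    (real CARD('a) ^ (b - t + 1) - 1) ^ u * TI_count CARD('a) CARD('n) a (cover_number t B)"
  using K
proof (induction u arbitrary: K)
  case 0
  then show ?case using card_above_le_TI_count[OF A a, of K] by simp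
next
  case (Suc u)
  have "\<not> covers t B K" using cover_number_le[of t B K] Suc.prems by auto
  then obtain G where G: "G \<in> B" "vec.dim (K \<inter> G) < t"
    using Suc.prems by (auto simp: covers_def not_le)
  have sG: "vec.subspace G" "vec.dim G = b" using G B TI_subspacesD by auto
  have "real (card {F \<in> A. K \<subseteq> F}) \<le> (real CARD('a) ^ (vec.dim G - t + 1) - 1) *
    ((real CARD('a) ^ (b - t + 1) - 1) ^ u * TI_count CARD('a) CARD('n) a (cover_number t B))"
  proof (rule card_above_branch[OF Suc.prems(1) sG(1) G(2)])
    show "t \<le> vec.dim G" using sG \<open>t \<le> b\<close> by simp
    show "vec.subspace F \<and> t \<le> vec.dim (F \<inter> G)" if "F \<in> A" for F
      using that A cross G(1) TI_subspacesD by (auto simp: cross_intersecting_def)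
    show "real (card {F \<in> A. vec.span (insert x K) \<subseteq> F}) \<le>
      (real CARD('a) ^ (b - t + 1) - 1) ^ u * TI_count CARD('a) CARD('n) a (cover_number t B)" if "x \<notin> K" for x
      using dim_span_insert_subspace[OF Suc.prems(1) that] Suc.prems
      by (intro Suc.IH) (auto simp del: vec.dim_span)
  qed
  then show ?case using sG by simp
qed

text \<open>Every member of A contains a t-subspace of the cover S. So S governs the number of
  starting points, whereas the covering number of B governs the branching.\<close>

lemma card_family_le:
  assumes A: "A \<subseteq> TI_subspaces f a" and B: "B \<subseteq> TI_subspaces f b"
    and cross: "cross_intersecting t A B" and "t \<le> b" and a: "2 * a \<le> CARD('n)"
    and r: "t \<le> cover_number t B"
    and S: "covers t A S" "t \<le> vec.dim S"
  shows "real (card A) \<le> subspace_count CARD('a) (vec.dim S) t *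
    ((real CARD('a) ^ (b - t + 1) - 1) ^ (cover_number t B - t) * TI_count CARD('a) CARD('n) a (cover_number t B))"
    (is "_ \<le> _ * ?c")
proof -
  let ?Ts = "{T. vec.subspace T \<and> T \<subseteq> S \<and> vec.dim T = t}"
  have sS: "vec.subspace S" using S by (simp add: covers_def)
  have "A \<subseteq> (\<Union>T\<in>?Ts. {F \<in> A. T \<subseteq> F})"
  proof
    fix F assume F: "F \<in> A"
    then have "vec.subspace F" using A TI_subspacesD by blast
    then have SF: "vec.subspace (S \<inter> F)" using sS by (rule vec.subspace_inter[rotated])
    obtain T where "vec.subspace T" "T \<subseteq> vec.span (S \<inter> F)" "vec.dim T = t"
      using vec.choose_subspace_of_subspace[of t "S \<inter> F"] S F by (auto simp: covers_def)
    moreover have "vec.span (S \<inter> F) = S \<inter> F" using SF by (rule vec.span_eq_iff[THEN iffD2])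
    ultimately show "F \<in> (\<Union>T\<in>?Ts. {F \<in> A. T \<subseteq> F})" using F by auto
  qed
  then have "card A \<le> card (\<Union>T\<in>?Ts. {F \<in> A. T \<subseteq> F})"
    by (intro card_mono) auto
  also have "\<dots> \<le> (\<Sum>T\<in>?Ts. card {F \<in> A. T \<subseteq> F})"
    by (rule card_UN_le) simp
  finally have "real (card A) \<le> (\<Sum>T\<in>?Ts. real (card {F \<in> A. T \<subseteq> F}))"
    by (simp only: of_nat_le_iff flip: of_nat_sum)
  also have "\<dots> \<le> (\<Sum>T\<in>?Ts. ?c)"
    using r by (intro sum_mono card_above_le[OF A B cross \<open>t \<le> b\<close> a]) auto
  also have "\<dots> = subspace_count CARD('a) (vec.dim S) t * ?c"
    using card_subspaces_of_dim[OF sS S(2)] by simp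
  finally show ?thesis .
qed

end

text \<open>Passes from pairs to d families. Some y i is at least 1, so all others are at most 1,
  and 1 \<le> \<Prod> y \<le> y i * y j \<le> 1.\<close>

lemma pairwise_products_le_1:
  fixes y :: "'i \<Rightarrow> real"
  assumes I: "finite I" and pos: "\<And>i. i \<in> I \<Longrightarrow> 0 < y i"
    and le: "\<And>i j. i \<in> I \<Longrightarrow> j \<in> I \<Longrightarrow> i \<noteq> j \<Longrightarrow> y i * y j \<le> 1"
    and ge: "1 \<le> (\<Prod>i\<in>I. y i)" and "I \<noteq> {}"
  obtains i where "i \<in> I" "\<And>j. j \<in> I \<Longrightarrow> i \<noteq> j \<Longrightarrow> y i * y j = 1"
proof -
  have "\<exists>i\<in>I. 1 \<le> y i"
  proof (rule ccontr)
    assume "\<not> (\<exists>i\<in>I. 1 \<le> y i)"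
    moreover obtain k where "k \<in> I" using \<open>I \<noteq> {}\<close> by blast
    ultimately have "(\<Prod>i\<in>I. y i) < (\<Prod>i\<in>I. 1)"
      using pos I by (intro prod_mono_strict[of k]) (auto simp: less_imp_le not_le)
    then show False using ge by simp
  qed
  then obtain i where i: "i \<in> I" "1 \<le> y i" by blast
  have "y i * y j = 1" if j: "j \<in> I" "i \<noteq> j" for j
  proof -
    have "(\<Prod>k\<in>I - {i} - {j}. y k) \<le> 1"
    proof (rule prod_le_1)
      fix k assume k: "k \<in> I - {i} - {j}"
      then have "1 * y k \<le> y i * y k" "y i * y k \<le> 1" "0 < y k"
        using i pos[of k] le[of i k] by (auto intro!: mult_right_mono)
      then show "0 \<le> y k \<and> y k \<le> 1" by linarith
    qed
    then have "y i * y j * (\<Prod>k\<in>I - {i} - {j}. y k) \<le> y i * y j * 1"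
      using pos i j by (intro mult_left_mono) (auto simp: less_imp_le)
    moreover have "(\<Prod>k\<in>I. y k) = y i * y j * (\<Prod>k\<in>I - {i} - {j}. y k)"
      using I i j by (simp add: prod.remove[of I i] prod.remove[of "I - {i}" j] mult.assoc)
    ultimately show ?thesis using le[OF i(1) j] ge by simp
  qed
  then show ?thesis using that i by blast
qed

section \<open>Extremal pairs of cross-intersecting families\<close>

context symplectic_space
begin

text \<open>In the case of equality only A is described; the other families are then placed by
  \<open>star_cross_intersecting\<close>.\<close>

lemma cross_intersecting_card:
  assumes A: "A \<subseteq> TI_subspaces f a" "A \<noteq> {}" and B: "B \<subseteq> TI_subspaces f b" "B \<noteq> {}"
    and cross: "cross_intersecting t A B" and t: "t \<le> a" "t \<le> b"
    and n: "2 * a + b + 1 \<le> CARD('n)" "2 * b + a + 1 \<le> CARD('n)"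
  defines "N \<equiv> \<lambda>m. TI_count CARD('a) CARD('n) m t"
  shows cross_intersecting_card_le: "real (card A) * real (card B) \<le> N a * N b"
    and cross_intersecting_card_eqD:
      "real (card A) * real (card B) = N a * N b \<Longrightarrow> \<exists>T\<in>TI_subspaces f t. A = star a T"
proof -
  have q: "2 \<le> CARD('a)" by (rule card_scalars_ge2)
  have cross': "cross_intersecting t B A"
    using cross by (simp only: cross_intersecting_commute[of t A])
  have ab: "2 * a \<le> CARD('n)" "2 * b \<le> CARD('n)" using n by auto
  define r where "r = cover_number t B"
  define s where "s = cover_number t A"
  obtain F G where FG: "F \<in> A" "G \<in> B" using A B by blast
  \<comment> \<open>Each member of one family covers the other, whence r \<le> a and s \<le>
    b.\<close>
  have "covers t A G" "covers t B F"
    using FG A(1) B(1) cross cross' TI_subspacesD by (auto simp: covers_def cross_intersecting_def)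
  then obtain SA SB where S: "covers t A SA" "vec.dim SA = s" "covers t B SB" "vec.dim SB = r"
    unfolding r_def s_def using obtain_minimal_cover by metis
  have rs: "t \<le> r" "r \<le> a" "t \<le> s" "s \<le> b"
    using le_dim_cover[OF S(1) A(2)] le_dim_cover[OF S(3) B(2)] S(2,4)
      cover_number_le[OF \<open>covers t A G\<close>] cover_number_le[OF \<open>covers t B F\<close>]
      FG A(1) B(1) TI_subspacesD by (auto simp: r_def s_def)
  let ?g = "\<lambda>s. subspace_count CARD('a) s t"
  let ?pA = "(real CARD('a) ^ (b - t + 1) - 1) ^ (r - t) * TI_count CARD('a) CARD('n) a r"
  let ?pB = "(real CARD('a) ^ (a - t + 1) - 1) ^ (s - t) * TI_count CARD('a) CARD('n) b s"
  have cA: "real (card A) \<le> ?g s * ?pA"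
    using card_family_le[OF A(1) B(1) cross t(2) ab(1) _ S(1)] S(2) rs by (simp add: r_def)
  have cB: "real (card B) \<le> ?g r * ?pB"
    using card_family_le[OF B(1) A(1) cross' t(1) ab(2) _ S(3)] S(4) rs by (simp add: s_def)
  have N: "0 < N a" "0 < N b"
    unfolding N_def using TI_count_CARD_pos ab by auto
  have lessA: "?g r * ?pA < N a" if "r \<noteq> t"
    using branching_bound_less[OF q, of "r - t" t a b "CARD('n)"] that rs t n by (simp add: N_def)
  have lessB: "?g s * ?pB < N b" if "s \<noteq> t"
    using branching_bound_less[OF q, of "s - t" t b a "CARD('n)"] that rs t n by (simp add: N_def)
  have leA: "?g r * ?pA \<le> N a"
    using lessA by (cases "r = t") (auto simp: subspace_count_self[OF q] N_def)
  have leB: "?g s * ?pB \<le> N b"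
    using lessB by (cases "s = t") (auto simp: subspace_count_self[OF q] N_def)
  have pos: "0 < card A" "0 < card B" using A B by (auto simp: card_gt_0_iff)
  have g: "0 < ?g r" "0 < ?g s" using subspace_count_pos[OF q] rs by auto
  have "0 < ?pA" "0 < ?pB"
    using cA cB pos g by (smt (verit) of_nat_0_less_iff zero_less_mult_pos)+
  then have gp: "0 < ?g r * ?pA" "0 < ?g s * ?pB" using g by simp_all
  have "real (card A) * real (card B) \<le> (?g s * ?pA) * (?g r * ?pB)"
    using cA cB pos by (intro mult_mono) auto
  \<comment> \<open>Swapping the Gaussian factors makes the first bracket depend on r alone and the
    second on s alone, as \<open>branching_bound_less\<close> requires.\<close>
  also have "\<dots> = (?g r * ?pA) * (?g s * ?pB)" by (simp only: ac_simps)
  finally have le: "real (card A) * real (card B) \<le> (?g r * ?pA) * (?g s * ?pB)" .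
  show "real (card A) * real (card B) \<le> N a * N b"
    using le mult_mono[OF leA leB] N gp by simp
  assume eq: "real (card A) * real (card B) = N a * N b"
  \<comment> \<open>Otherwise one bracket would be strictly too small for equality.\<close>
  have "r = t"
    using mult_less_le_imp_less[OF lessA leB] le eq gp by force
  have "s = t"
    using mult_le_less_imp_less[OF leA lessB] le eq gp by force
  \<comment> \<open>A cover of dimension t meets each member in dimension t, hence lies inside
    it.\<close>
  have sub: "S \<subseteq> F" if "covers t X S" "vec.dim S = t" "F \<in> X" "vec.subspace F" for X S F
    using vec.subspace_dim_equal[of "S \<inter> F" S] that
    by (auto simp: covers_def vec.subspace_inter)
  have SA: "SA \<subseteq> F" if "F \<in> A" for F
    using sub[OF S(1)] S(2) \<open>s = t\<close> that A(1) TI_subspacesD by auto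
  have SB: "SB \<subseteq> G" if "G \<in> B" for G
    using sub[OF S(3)] S(4) \<open>r = t\<close> that B(1) TI_subspacesD by auto
  have sS: "vec.subspace SA" "vec.subspace SB" using S by (auto simp: covers_def)
  have "{F \<in> A. SA \<subseteq> F} = A" "{F \<in> B. SB \<subseteq> F} = B" using SA SB by auto
  then have "real (card A) \<le> N a" "real (card B) \<le> N b"
    using card_above_le_TI_count[OF A(1) ab(1) sS(1)] card_above_le_TI_count[OF B(1) ab(2) sS(2)]
      S \<open>s = t\<close> \<open>r = t\<close> by (simp_all add: N_def)
  then have "real (card A) = N a"
    using eq N pos mult_less_le_imp_less[of "real (card A)" "N a" "real (card B)" "N b"] by force
  have TI: "totally_isotropic f SA"
    using totally_isotropic_subset[OF _ sS(1) SA[OF FG(1)]] FG(1) A(1) TI_subspacesD by blast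
  have "real (card (star a SA)) = real (card A)"
    using card_TI_above[OF TI, of a] S(2) \<open>s = t\<close> t \<open>real (card A) = N a\<close> by (simp add: N_def)
  then have "A = star a SA"
    using A(1) SA by (intro card_subset_eq) auto
  then show "\<exists>T\<in>TI_subspaces f t. A = star a T"
    using TI S(2) \<open>s = t\<close> by (auto simp: TI_subspaces_def)
qed

text \<open>Forces all families into the star of the same T. If T were not inside G, branching once
  over G from T would leave fewer members than the full star has.\<close>

lemma star_cross_intersecting:
  assumes T: "T \<in> TI_subspaces f t" and cross: "cross_intersecting t (star a T) B"
    and G: "G \<in> B" "G \<in> TI_subspaces f b" and t: "t \<le> a" "t \<le> b"
    and n: "2 * a + b + 1 \<le> CARD('n)"
  shows "T \<subseteq> G"
proof (rule ccontr)
  assume "\<not> T \<subseteq> G"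
  have sT: "vec.subspace T" "vec.dim T = t" and sG: "vec.subspace G" "vec.dim G = b"
    using T G TI_subspacesD by auto
  have q: "2 \<le> CARD('a)" by (rule card_scalars_ge2)
  have TG: "vec.dim (T \<inter> G) < t"
    using vec.subspace_dim_equal[of "T \<inter> G" T] sT sG \<open>\<not> T \<subseteq> G\<close>
    by (auto simp: vec.subspace_inter not_less[symmetric])
  \<comment> \<open>For a = t the star contains T itself, which meets G in too small a
    dimension.\<close>
  then have "a \<noteq> t"
    using cross T G by (auto simp: cross_intersecting_def not_less[symmetric])
  then have "t < a" using t by simp
  let ?c = "TI_count CARD('a) CARD('n) a (Suc t)"
  have "real (card {F \<in> star a T. T \<subseteq> F}) \<le> (real CARD('a) ^ (vec.dim G - t + 1) - 1) * ?c"
  proof (rule card_above_branch[OF sT(1) sG(1) TG])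
    show "t \<le> vec.dim G" using t sG by simp
    show "vec.subspace F \<and> t \<le> vec.dim (F \<inter> G)" if "F \<in> star a T" for F
      using cross G(1) that TI_subspacesD unfolding cross_intersecting_def by blast
    show "real (card {F \<in> star a T. vec.span (insert x T) \<subseteq> F}) \<le> ?c" if "x \<notin> T" for x
      using card_above_le_TI_count[of "star a T" a "vec.span (insert x T)"]
        dim_span_insert_subspace[OF sT(1) that] n sT(2) by (auto simp del: vec.dim_span)
  qed
  moreover have "real (card {F \<in> star a T. T \<subseteq> F}) = TI_count CARD('a) CARD('n) a t"
    using card_TI_above[of T a] T t TI_subspacesD[OF T] by simp
  moreover have "(real CARD('a) ^ (b - t + 1) - 1) * ?c < real CARD('a) ^ (b + 2) * ?c"
  proof (rule mult_strict_right_mono)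
    have "real CARD('a) ^ (b - t + 1) \<le> real CARD('a) ^ (b + 2)"
      using q by (intro power_increasing) auto
    then show "real CARD('a) ^ (b - t + 1) - 1 < real CARD('a) ^ (b + 2)" by linarith
    show "0 < ?c" using TI_count_CARD_pos n by simp
  qed
  moreover have "real CARD('a) ^ (b + 2) * ?c \<le> TI_count CARD('a) CARD('n) a t"
    by (rule TI_count_Suc_le[OF q \<open>t < a\<close> n])
  ultimately show False using sG by simp
qed

end

section \<open>From pairs to d families\<close>

theorem theorem3p3:
  fixes f :: "'a::{finite,field} ^ 'n \<Rightarrow> 'a ^ 'n \<Rightarrow> 'a"
    and \<nu> d t :: nat and m :: "nat \<Rightarrow> nat"
    and \<F> :: "nat \<Rightarrow> ('a ^ 'n) set set"
  assumes dimV: "CARD('n) = 2 * \<nu>" and nu_pos: "\<nu> \<ge> 1"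
    and form: "bilinear_form f" "alternating_form f" "nondegenerate_form f"
    and d2: "d \<ge> 2" and t_pos: "t \<ge> 1"
    and m_mono: "\<And>i j. 1 \<le> i \<Longrightarrow> i \<le> j \<Longrightarrow> j \<le> d \<Longrightarrow> m j \<le> m i"
    and m_ge_t: "m d \<ge> t"
    and nu_bound: "2 * \<nu> \<ge> 2 * m 1 + m 2 + 1"
    and inter: "t_intersecting_tuple f d m t \<F>"
    and maximum: "\<And>\<G>. t_intersecting_tuple f d m t \<G> \<Longrightarrow>
                    (\<Prod>i\<in>{1..d}. card (\<G> i)) \<le> (\<Prod>i\<in>{1..d}. card (\<F> i))"
  shows "\<exists>T\<in>TI_subspaces f t. \<forall>i\<in>{1..d}. \<F> i = {F \<in> TI_subspaces f (m i). T \<subseteq> F}"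
proof -
  interpret symplectic_space f by standard (use form in auto)
  have q: "2 \<le> CARD('a)" by (rule card_scalars_ge2)
  define I where "I = {1..d}"
  define N where "N i = TI_count CARD('a) CARD('n) (m i) t" for i
  have m: "t \<le> m i" "m i \<le> m 1" if "i \<in> I" for i
    using m_mono[of 1 i] m_mono[of i d] m_ge_t that by (auto simp: I_def)
  \<comment> \<open>Of two distinct indices, the smaller has m at most m 1 and the larger at most m
    2; since m 2 \<le> m 1, the hypothesis on \<nu> serves both orders of the pair.\<close>
  have pair_bound: "2 * m i + m j + 1 \<le> CARD('n)" if "i \<in> I" "j \<in> I" "i \<noteq> j" for i j
  proof (cases "i < j")
    case True
    then have "m i \<le> m 1" "m j \<le> m 2"
      using that m_mono[of 1 i] m_mono[of 2 j] by (auto simp: I_def)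
    then show ?thesis using nu_bound dimV by simp
  next
    case False
    then have "m i \<le> m 2" "m j \<le> m 1" "m 2 \<le> m 1"
      using that d2 m_mono[of 1 j] m_mono[of 2 i] m_mono[of 1 2] by (auto simp: I_def)
    then show ?thesis using nu_bound dimV by simp
  qed
  have ge_2m: "2 * m i \<le> CARD('n)" if "i \<in> I" for i
    using m[OF that] nu_bound dimV by simp
  have N_pos: "0 < N i" if "i \<in> I" for i
    unfolding N_def using TI_count_CARD_pos ge_2m[OF that] by blast
  have TI: "\<F> i \<subseteq> TI_subspaces f (m i)" if "i \<in> I" for i
    using inter that by (simp add: t_intersecting_tuple_def I_def)
  have card_star: "real (card (star (m i) T)) = N i" if "i \<in> I" "T \<in> TI_subspaces f t" for i T
    using card_TI_above[of T "m i"] TI_subspacesD[OF that(2)] m(1)[OF that(1)] by (simp add: N_def)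

  \<comment> \<open>A positive count above {0} yields some T0, whose stars compete for the
    maximum.\<close>
  have "{F \<in> TI_subspaces f t. {0} \<subseteq> F} \<noteq> {}"
  proof -
    have "2 * t \<le> CARD('n)" using ge_2m[of d] m_ge_t d2 by (simp add: I_def)
    then have "0 < real (card {F \<in> TI_subspaces f t. {0} \<subseteq> F})"
      using card_TI_above[of "{0}" t] TI_count_CARD_pos[of t "0"]
      by (simp add: totally_isotropic_def)
    then show ?thesis by (auto simp: card_gt_0_iff)
  qed
  then obtain T0 where T0: "T0 \<in> TI_subspaces f t" by auto
  have "t_intersecting_tuple f d m t (\<lambda>i. star (m i) T0)"
    unfolding t_intersecting_tuple_def
  proof (intro conjI allI impI ballI)
    fix G assume "\<forall>i\<in>{1..d}. G i \<in> star (m i) T0"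
    then have "T0 \<subseteq> (\<Inter>i\<in>{1..d}. G i)" by auto
    then show "t \<le> vec.dim (\<Inter>i\<in>{1..d}. G i)"
      using vec.dim_subset TI_subspacesD[OF T0] by metis
  qed auto
  then have "(\<Prod>i\<in>I. card (star (m i) T0)) \<le> (\<Prod>i\<in>I. card (\<F> i))"
    unfolding I_def by (rule maximum)
  then have "real (\<Prod>i\<in>I. card (star (m i) T0)) \<le> real (\<Prod>i\<in>I. card (\<F> i))"
    by (simp only: of_nat_le_iff)
  then have ge: "(\<Prod>i\<in>I. N i) \<le> (\<Prod>i\<in>I. real (card (\<F> i)))"
    using card_star T0 by simp
  have prod_N: "0 < (\<Prod>i\<in>I. N i)" using N_pos by (intro prod_pos) auto
  \<comment> \<open>An empty family would give product 0, below that of the stars.\<close>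
  have card_pos: "0 < card (\<F> i)" if "i \<in> I" for i
  proof (rule ccontr)
    assume "\<not> 0 < card (\<F> i)"
    then have "(\<Prod>i\<in>I. real (card (\<F> i))) = 0"
      using that by (intro prod_zero) (auto simp: I_def)
    then show False using ge prod_N by simp
  qed
  have nonempty: "\<F> i \<noteq> {}" if "i \<in> I" for i using card_pos[OF that] by auto

  have cross: "cross_intersecting t (\<F> i) (\<F> j)" if ij: "i \<in> I" "j \<in> I" "i \<noteq> j" for i j
    unfolding cross_intersecting_def
  proof (intro ballI)
    fix F G assume FG: "F \<in> \<F> i" "G \<in> \<F> j"
    \<comment> \<open>The pair is completed to a full tuple by arbitrary members, available since no
      family is empty.\<close>
    define H where "H k = (if k = i then F else if k = j then G else SOME E. E \<in> \<F> k)" for k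
    have "H k \<in> \<F> k" if "k \<in> I" for k
      using FG nonempty[OF that] by (auto simp: H_def some_in_eq)
    then have "t \<le> vec.dim (\<Inter>k\<in>{1..d}. H k)"
      using inter by (simp add: t_intersecting_tuple_def I_def)
    moreover have "(\<Inter>k\<in>{1..d}. H k) \<subseteq> H i \<inter> H j"
      using ij unfolding I_def by blast
    moreover have "H i = F" "H j = G" using ij by (auto simp: H_def)
    ultimately show "t \<le> vec.dim (F \<inter> G)"
      using vec.dim_subset[of "\<Inter>k\<in>{1..d}. H k" "F \<inter> G"] by simp
  qed

  \<comment> \<open>Sizes relative to full stars: pairwise products are at most 1 by the two-family
    bound, the full product is at least 1 by maximality.\<close>
  define y where "y i = real (card (\<F> i)) / N i" for i
  note pair = cross_intersecting_card[OF TI nonempty TI nonempty cross m(1) m(1) pair_bound pair_bound]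
  have pair_le: "real (card (\<F> i)) * real (card (\<F> j)) \<le> N i * N j"
    if "i \<in> I" "j \<in> I" "i \<noteq> j" for i j
    unfolding N_def by (rule pair(1)) (use that in auto)
  have pair_eqD: "\<exists>T\<in>TI_subspaces f t. \<F> i = star (m i) T"
    if "real (card (\<F> i)) * real (card (\<F> j)) = N i * N j" "i \<in> I" "j \<in> I" "i \<noteq> j" for i j
    by (rule pair(2)) (use that in \<open>auto simp: N_def\<close>)
  have yy: "y i * y j = real (card (\<F> i)) * real (card (\<F> j)) / (N i * N j)" for i j
    by (simp add: y_def)
  have y_pos: "0 < y i" if "i \<in> I" for i
    using card_pos[OF that] N_pos[OF that] by (simp add: y_def)
  have "y i * y j \<le> 1" if "i \<in> I" "j \<in> I" "i \<noteq> j" for i j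
    using pair_le[OF that] N_pos[OF that(1)] N_pos[OF that(2)] by (simp add: yy divide_le_eq)
  moreover have "1 \<le> (\<Prod>i\<in>I. y i)"
    using ge prod_N by (simp add: y_def prod_dividef)
  moreover have "finite I" "I \<noteq> {}" using d2 by (auto simp: I_def)
  ultimately obtain i where i: "i \<in> I" "\<And>j. j \<in> I \<Longrightarrow> i \<noteq> j \<Longrightarrow> y i * y j = 1"
    using pairwise_products_le_1[of I y] y_pos by metis
  obtain j0 where j0: "j0 \<in> I" "i \<noteq> j0"
    using d2 that[of 1] that[of 2] by (cases "i = 1") (auto simp: I_def)
  have "real (card (\<F> i)) * real (card (\<F> j0)) = N i * N j0"
    using i(2)[OF j0] N_pos[OF i(1)] N_pos[OF j0(1)] by (simp add: yy)
  then obtain T where T: "T \<in> TI_subspaces f t" "\<F> i = star (m i) T"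
    using pair_eqD[OF _ i(1) j0] by blast
  \<comment> \<open>Family i is a full star, so the equalities y i * y j = 1 give every other family
    the size of a star.\<close>
  have "y i = 1"
    using card_star[OF i(1) T(1)] T(2) N_pos[OF i(1)] by (simp add: y_def)
  have "\<F> j = star (m j) T" if j: "j \<in> I" "i \<noteq> j" for j
  proof (rule card_subset_eq)
    show "finite (star (m j) T)" by simp
    have "T \<subseteq> G" if "G \<in> \<F> j" for G
      using star_cross_intersecting[OF T(1), of "m i" "\<F> j" G "m j"] cross[OF i(1) j] T(2)
        that TI j m(1) i(1) pair_bound[OF i(1) j] by auto
    then show "\<F> j \<subseteq> star (m j) T" using TI[OF j(1)] by auto
    have "y j = 1" using i(2)[OF j] \<open>y i = 1\<close> by simp
    then have "real (card (\<F> j)) = real (card (star (m j) T))"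
      using card_star[OF j(1) T(1)] N_pos[OF j(1)] by (simp add: y_def)
    then show "card (\<F> j) = card (star (m j) T)" by (simp only: of_nat_eq_iff)
  qed
  then have "\<F> j = star (m j) T" if "j \<in> I" for j
    using T(2) that by (cases "i = j") auto
  then show ?thesis using T(1) by (auto simp: I_def)
qed

end
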